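(* Let $\alpha\in(0,1)$. Assume the following. (1) $f:[0,1]\times\mathbb{R}\times\mathbb{R}\to\mathbb{R}\setminus\{0\}$ and $g:[0,1]\times\mathbb{R}\times\mathbb{R}\to\mathbb{R}$ are continuous. (2) $\varphi,\rho:[0,1]\to[0,1]$ are continuous. (3) There are constants $k,r\in(0,1)$ such that for all $t\in[0,1]$ and all $x_1,x_2,y_1,y_2\in\mathbb{R}$, $$|f(t,x_1,y_1)-f(t,x_2,y_2)|\le\left(\max(|x_1-x_2|,|y_1-y_2|)+1\right)^k-1$$ and $$|g(t,x_1,y_1)-g(t,x_2,y_2)|\le\left(\max(|x_1-x_2|,|y_1-y_2|)+1\right)^r-1.$$ (4) With $K_1=\sup\{|f(t,0,0)|:t\in[0,1]\}$ and $K_2=\sup\{|g(t,0,0)|:t\in[0,1]\}$, there exists $r_0>0$ such that $$\left((r_0+1)^k-1+K_1\right)\left((r_0+1)^r-1+K_2\right)\le r_0\,\Gamma(\alpha+1)$$ and $$(r_0+1)^r-1+K_2\le\Gamma(\alpha+1).$$ Then the problem $$D_{0+}^\alpha\left[\frac{x(t)}{f(t,x(t),x(\varphi(t)))}\right]=g(t,x(t),x(\rho(t))),\quad 0<t<1,\qquad x(0)=0,$$ has at least one solution $x\in C[0,1]$.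
   Context: $C[0,1]$ is the space of continuous real-valued functions on $[0,1]$. $\Gamma$ is the gamma function. For $0<\alpha<1$, the Riemann–Liouville fractional derivative of order $\alpha$ of a function $u$ is $$D_{0+}^\alpha u(t)=\frac{1}{\Gamma(1-\alpha)}\frac{d}{dt}\int_0^t\frac{u(s)}{(t-s)^{\alpha}}\,ds,$$ whenever the right-hand side is defined. A solution in $C[0,1]$ is a function $x\in C[0,1]$ with $x(0)=0$ such that, for $u(t)=x(t)/f(t,x(t),x(\varphi(t)))$, the derivative $D_{0+}^\alpha u(t)$ exists and equals $g(t,x(t),x(\rho(t)))$ for every $t\in(0,1)$. *)

theory Defs
  imports "HOL-Analysis.Analysis"
begin

definition RL_kernel_integral :: "real \<Rightarrow> (real \<Rightarrow> real) \<Rightarrow> real \<Rightarrow> real" where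
  "RL_kernel_integral \<alpha> u t = (LINT s:{0..t}|lebesgue. u s / (t - s) powr \<alpha>)"

definition RL_derivative :: "real \<Rightarrow> (real \<Rightarrow> real) \<Rightarrow> real \<Rightarrow> real" where
  "RL_derivative \<alpha> u t = 1 / Gamma (1 - \<alpha>) * deriv (RL_kernel_integral \<alpha> u) t"

text \<open>
  Integrals and derivatives are total functions here, so the existence of the fractional
  derivative at an interior point \<open>t\<close> is a separate predicate: the integral has to exist for all
  upper limits near \<open>t\<close>, and it has to be differentiable at \<open>t\<close>.
\<close>

definition RL_differentiable :: "real \<Rightarrow> (real \<Rightarrow> real) \<Rightarrow> real \<Rightarrow> bool" where
  "RL_differentiable \<alpha> u t \<longleftrightarrow>
     (\<forall>\<^sub>F \<tau> in nhds t. set_integrable lebesgue {0..\<tau>} (\<lambda>s. u s / (\<tau> - s) powr \<alpha>)) \<and>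
     RL_kernel_integral \<alpha> u differentiable (at t)"

text \<open>
  Functions on \<open>[0,1]\<close> are represented by total functions on the reals. Only their values on
  \<open>[0,1]\<close> matter below: for \<open>t\<close> in \<open>(0,1)\<close> the integrals near \<open>t\<close> range over subintervals
  of \<open>[0,1]\<close>.
\<close>

definition is_solution ::
  "real \<Rightarrow> (real \<Rightarrow> real \<Rightarrow> real \<Rightarrow> real) \<Rightarrow> (real \<Rightarrow> real \<Rightarrow> real \<Rightarrow> real) \<Rightarrow>
   (real \<Rightarrow> real) \<Rightarrow> (real \<Rightarrow> real) \<Rightarrow> (real \<Rightarrow> real) \<Rightarrow> bool" where
  "is_solution \<alpha> f g \<phi> \<rho> x \<longleftrightarrow>
     continuous_on {0..1} x \<and> x 0 = 0 \<and>
     (\<forall>t\<in>{0<..<1}.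
        RL_differentiable \<alpha> (\<lambda>s. x s / f s (x s) (x (\<phi> s))) t \<and>
        RL_derivative \<alpha> (\<lambda>s. x s / f s (x s) (x (\<phi> s))) t = g t (x t) (x (\<rho> t)))"

end

theory Submission
  imports Defs "HOL-Complex_Analysis.Great_Picard"
begin

text \<open>
  Write \<open>F x\<close> and \<open>G x\<close> for the functions \<open>t \<mapsto> f t (x t) (x (\<phi> t))\<close> and
  \<open>t \<mapsto> g t (x t) (x (\<rho> t))\<close>, and \<open>I\<close> for the fractional integral of order \<open>\<alpha>\<close>. Since
  \<open>(d + 1)\<^bsup>k\<^esup> - 1 \<le> k d\<close>, both \<open>F\<close> and \<open>G\<close> are Lipschitz contractions in the supremum norm.
  Put \<open>h = I (G x)\<close>; the equation becomes \<open>x = h * F x\<close>. On the ball of radius \<open>r\<^sub>0\<close> the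
  second inequality of (4) gives \<open>norm h \<le> 1\<close>, so for fixed \<open>h\<close> the map \<open>x \<mapsto> h * F x\<close>
  contracts with factor \<open>k\<close>, and the first inequality makes the ball invariant. Its unique fixed
  point \<open>\<Phi> h\<close> depends continuously on \<open>h\<close>. The remaining map \<open>h \<mapsto> I (G (\<Phi> h))\<close> sends a
  compact convex set of Hoelder continuous functions into itself, so it has a fixed point by
  Schauder's theorem. Schauder's theorem comes from Brouwer's on a cube of arbitrary dimension,
  for which Kuhn's combinatorial lemma is used directly: the
  dimension is the size of a net, so it cannot be fixed by a type.
\<close>

section \<open>Fixed point theorems of Brouwer and Schauder\<close>

lemma tendsto_fun_iff:
  fixes X :: "'c \<Rightarrow> 'a \<Rightarrow> 'b::topological_space"
  shows "(X \<longlongrightarrow> c) F \<longleftrightarrow> (\<forall>i. ((\<lambda>m. X m i) \<longlongrightarrow> c i) F)"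
  using limitin_componentwise[of "\<lambda>_. euclidean" UNIV X c F]
  by (simp add: euclidean_product_topology)

text \<open>Tychonoff's theorem. With indices in \<open>nat\<close>, every finite dimension fits
  into this one cube.\<close>

lemma compact_unit_cube_fun:
  "compact {c :: 'a \<Rightarrow> real. \<forall>i. 0 \<le> c i \<and> c i \<le> 1}"
proof -
  have "compactin (product_topology (\<lambda>_. euclidean) UNIV) (PiE UNIV (\<lambda>_::'a. {0..1::real}))"
    by (simp add: compactin_PiE)
  moreover have "PiE UNIV (\<lambda>_::'a. {0..1::real}) = {c. \<forall>i. 0 \<le> c i \<and> c i \<le> 1}"
    by (auto simp: PiE_iff)
  ultimately show ?thesis
    by (simp add: euclidean_product_topology)
qed

text \<open>Kuhn's lemma on the grid of mesh \<open>1 / p\<close>: label 0 marks a coordinate that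
  \<open>H\<close> does not decrease. The cell with lowest corner \<open>q\<close> has, for every
  coordinate, vertices of both labels; they serve as \<open>a\<close> and \<open>b\<close>.\<close>

lemma brouwer_grid_approximation:
  fixes H :: "(nat \<Rightarrow> real) \<Rightarrow> nat \<Rightarrow> real" and n p :: nat
  defines "Q \<equiv> {c. \<forall>i. 0 \<le> c i \<and> c i \<le> 1}"
  assumes p: "0 < p"
    and H: "\<And>c i. \<lbrakk>c \<in> Q; i < n\<rbrakk> \<Longrightarrow> 0 \<le> H c i \<and> H c i \<le> 1"
  obtains q where "q \<in> Q"
    "\<And>i. i < n \<Longrightarrow> \<exists>a\<in>Q. (\<forall>j. \<bar>a j - q j\<bar> \<le> 1 / p) \<and> a i \<le> H a i"
    "\<And>i. i < n \<Longrightarrow> \<exists>b\<in>Q. (\<forall>j. \<bar>b j - q j\<bar> \<le> 1 / p) \<and> H b i \<le> b i"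
proof -
  define pt where "pt x = (\<lambda>i. if i < n then real (x i) / p else 0)" for x :: "nat \<Rightarrow> nat"
  \<comment> \<open>The clause \<open>x i \<noteq> p\<close> forces label 1 on the face
    \<open>x i = p\<close>, even if \<open>H\<close> fixes the coordinate there. On the face
    \<open>x i = 0\<close>, label 0 follows from \<open>0 \<le> H\<close>.\<close>
  define label where
    "label x i = (if x i \<noteq> p \<and> pt x i \<le> H (pt x) i then 0 else 1::nat)" for x i
  have ptQ: "pt x \<in> Q" if "\<forall>i<n. x i \<le> p" for x
    using that p by (auto simp: pt_def Q_def field_simps)
  have l0: "\<forall>x. (\<forall>i<n. x i \<le> p) \<longrightarrow> (\<forall>i<n. x i = 0 \<longrightarrow> label x i = 0)"
  proof (intro allI impI)
    fix x i assume x: "\<forall>i<n. x i \<le> p" "i < n" "x i = 0"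
    then have "pt x i = 0" by (simp add: pt_def)
    then show "label x i = 0"
      using H[OF ptQ[OF x(1)] x(2)] p x(3) by (simp add: label_def)
  qed
  have l1: "\<forall>x. (\<forall>i<n. x i \<le> p) \<longrightarrow> (\<forall>i<n. x i = p \<longrightarrow> label x i = 1)"
    and l01: "\<forall>x. (\<forall>i<n. x i \<le> p) \<longrightarrow> (\<forall>i<n. label x i = 0 \<or> label x i = 1)"
    by (simp_all add: label_def)
  obtain q where q: "\<forall>i<n. q i < p"
    and rs: "\<forall>i<n. \<exists>r s. (\<forall>j<n. q j \<le> r j \<and> r j \<le> q j + 1) \<and>
      (\<forall>j<n. q j \<le> s j \<and> s j \<le> q j + 1) \<and> label r i \<noteq> label s i"
    using kuhn_lemma[OF p l01 l0 l1] by blast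
  have near: "\<bar>pt x j - pt q j\<bar> \<le> 1 / p" if "\<forall>j<n. q j \<le> x j \<and> x j \<le> q j + 1" for x j
  proof (cases "j < n")
    case True
    then have "q j \<le> x j" "x j \<le> q j + 1" using that by blast+
    then have "real (x j) - real (q j) \<le> 1" "0 \<le> real (x j) - real (q j)" by linarith+
    then show ?thesis using True p
      by (simp add: pt_def diff_divide_distrib[symmetric] divide_right_mono)
  qed (simp add: pt_def)
  \<comment> \<open>As \<open>q j\<close> is strictly below \<open>p\<close>, all vertices of the
    cell stay in the grid.\<close>
  have xp: "\<forall>j<n. x j \<le> p" if "\<forall>j<n. q j \<le> x j \<and> x j \<le> q j + 1" for x
  proof (intro allI impI)
    fix j assume "j < n"
    then have "q j < p" "x j \<le> q j + 1" using that q by blast+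
    then show "x j \<le> p" by linarith
  qed
  have lab0: "pt x i \<le> H (pt x) i" if "label x i = 0" for x i
    using that by (auto simp: label_def split: if_splits)
  have lab1: "H (pt x) i \<le> pt x i" if "label x i \<noteq> 0" "\<forall>j<n. x j \<le> p" "i < n" for x i
  proof (cases "x i = p")
    case True
    then show ?thesis using H[OF ptQ[OF that(2)] that(3)] p that(3) by (simp add: pt_def)
  next
    case False
    then show ?thesis using that(1) by (simp add: label_def split: if_splits)
  qed
  show thesis
  proof (rule that[of "pt q"])
    show "pt q \<in> Q" using ptQ q less_imp_le by blast
  next
    fix i assume i: "i < n"
    with rs obtain r s where r: "\<forall>j<n. q j \<le> r j \<and> r j \<le> q j + 1"
      and s: "\<forall>j<n. q j \<le> s j \<and> s j \<le> q j + 1" and ne: "label r i \<noteq> label s i"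
      by blast
    have r': "pt r \<in> Q" "\<forall>j. \<bar>pt r j - pt q j\<bar> \<le> 1 / p"
      and s': "pt s \<in> Q" "\<forall>j. \<bar>pt s j - pt q j\<bar> \<le> 1 / p"
      using ptQ[OF xp[OF r]] ptQ[OF xp[OF s]] near[OF r] near[OF s] by blast+
    consider "label r i = 0" "label s i \<noteq> 0" | "label r i \<noteq> 0" "label s i = 0"
      using ne by (cases "label r i = 0") (simp_all add: label_def split: if_splits)
    then have "(\<exists>a\<in>Q. (\<forall>j. \<bar>a j - pt q j\<bar> \<le> 1 / p) \<and> a i \<le> H a i) \<and>
      (\<exists>b\<in>Q. (\<forall>j. \<bar>b j - pt q j\<bar> \<le> 1 / p) \<and> H b i \<le> b i)"
    proof cases
      case 1
      show ?thesis
        by (intro conjI bexI[of _ "pt r"] bexI[of _ "pt s"] r' s'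
            lab0[OF 1(1)] lab1[OF 1(2) xp[OF s] i])
    next
      case 2
      show ?thesis
        by (intro conjI bexI[of _ "pt s"] bexI[of _ "pt r"] r' s'
            lab0[OF 2(2)] lab1[OF 2(1) xp[OF r] i])
    qed
    then show "\<exists>a\<in>Q. (\<forall>j. \<bar>a j - pt q j\<bar> \<le> 1 / p) \<and> a i \<le> H a i"
      and "\<exists>b\<in>Q. (\<forall>j. \<bar>b j - pt q j\<bar> \<le> 1 / p) \<and> H b i \<le> b i"
      by blast+
  qed
qed

text \<open>The points \<open>a\<close> and \<open>b\<close> found for mesh \<open>1 / Suc m\<close>
  lie close to \<open>q m\<close>. Along a subsequence all of them converge to one \<open>c\<close>,
  where continuity merges the two inequalities into \<open>H c i = c i\<close>.\<close>

lemma brouwer_cube_fun: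
  fixes H :: "(nat \<Rightarrow> real) \<Rightarrow> nat \<Rightarrow> real" and n :: nat
  defines "Q \<equiv> {c. \<forall>i. 0 \<le> c i \<and> c i \<le> 1}"
  assumes cont: "\<And>i. i < n \<Longrightarrow> continuous_on Q (\<lambda>c. H c i)"
    and H: "\<And>c i. \<lbrakk>c \<in> Q; i < n\<rbrakk> \<Longrightarrow> 0 \<le> H c i \<and> H c i \<le> 1"
  obtains c where "c \<in> Q" "\<And>i. i < n \<Longrightarrow> H c i = c i"
proof -
  have "\<forall>m. \<exists>q. q \<in> Q \<and>
    (\<forall>i. i < n \<longrightarrow> (\<exists>a\<in>Q. (\<forall>j. \<bar>a j - q j\<bar> \<le> 1 / Suc m) \<and> a i \<le> H a i)) \<and>
    (\<forall>i. i < n \<longrightarrow> (\<exists>b\<in>Q. (\<forall>j. \<bar>b j - q j\<bar> \<le> 1 / Suc m) \<and> H b i \<le> b i))"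
    (is "\<forall>m. ?P m")
  proof
    fix m
    obtain q where "q \<in> Q"
      "\<And>i. i < n \<Longrightarrow> \<exists>a\<in>Q. (\<forall>j. \<bar>a j - q j\<bar> \<le> 1 / Suc m) \<and> a i \<le> H a i"
      "\<And>i. i < n \<Longrightarrow> \<exists>b\<in>Q. (\<forall>j. \<bar>b j - q j\<bar> \<le> 1 / Suc m) \<and> H b i \<le> b i"
      unfolding Q_def
      by (rule brouwer_grid_approximation[of "Suc m" n H]) (use H in \<open>simp_all add: Q_def\<close>)
    then show "?P m" by blast
  qed
  from choice[OF this] obtain q where q: "\<And>m. q m \<in> Q"
    and lo: "\<And>m i. i < n \<Longrightarrow> \<exists>a\<in>Q. (\<forall>j. \<bar>a j - q m j\<bar> \<le> 1 / Suc m) \<and> a i \<le> H a i"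
    and hi: "\<And>m i. i < n \<Longrightarrow> \<exists>b\<in>Q. (\<forall>j. \<bar>b j - q m j\<bar> \<le> 1 / Suc m) \<and> H b i \<le> b i"
    by blast
  \<comment> \<open>The index type is countable, so the product topology is metrizable.\<close>
  have "seq_compact Q"
    using compact_unit_cube_fun[where 'a=nat] by (simp add: Q_def compact_eq_seq_compact_metric)
  then obtain c \<sigma> where c: "c \<in> Q" and \<sigma>: "strict_mono \<sigma>" and lim: "(q \<circ> \<sigma>) \<longlonglongrightarrow> c"
    using q by (blast elim: seq_compactE)
  have inv0: "(\<lambda>m. 1 / real (Suc (\<sigma> m))) \<longlonglongrightarrow> 0"
    using LIMSEQ_subseq_LIMSEQ[OF lim_1_over_n[where 'a=real] strict_mono_o[of Suc \<sigma>]] \<sigma>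
    by (simp add: o_def strict_mono_Suc_iff)
  have conv: "(\<lambda>m. A m) \<longlonglongrightarrow> c"
    if "\<And>m j. \<bar>A m j - q (\<sigma> m) j\<bar> \<le> 1 / Suc (\<sigma> m)" for A
    unfolding tendsto_fun_iff
  proof
    fix j
    have "(\<lambda>m. A m j - q (\<sigma> m) j) \<longlonglongrightarrow> 0"
      using inv0 by (rule Lim_null_comparison[rotated]) (use that in auto)
    moreover have "(\<lambda>m. q (\<sigma> m) j) \<longlonglongrightarrow> c j"
      using lim by (simp add: tendsto_fun_iff)
    ultimately have "(\<lambda>m. (A m j - q (\<sigma> m) j) + q (\<sigma> m) j) \<longlonglongrightarrow> 0 + c j"
      by (rule tendsto_add)
    then show "(\<lambda>m. A m j) \<longlonglongrightarrow> c j" by simp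
  qed
  have contH: "(\<lambda>m. H (A m) i) \<longlonglongrightarrow> H c i" if "i < n" "\<And>m. A m \<in> Q" "A \<longlonglongrightarrow> c" for A i
    using continuous_on_tendsto_compose[OF cont[OF that(1)] that(3) c] that(2) by simp
  show thesis
  proof (rule that[OF c])
    fix i assume i: "i < n"
    have "\<forall>m. \<exists>a. a \<in> Q \<and> (\<forall>j. \<bar>a j - q (\<sigma> m) j\<bar> \<le> 1 / Suc (\<sigma> m)) \<and> a i \<le> H a i"
      using lo[OF i] by blast
    from choice[OF this] obtain a where a: "\<And>m. a m \<in> Q"
      "\<And>m j. \<bar>a m j - q (\<sigma> m) j\<bar> \<le> 1 / Suc (\<sigma> m)" "\<And>m. a m i \<le> H (a m) i"
      by blast
    have "\<forall>m. \<exists>b. b \<in> Q \<and> (\<forall>j. \<bar>b j - q (\<sigma> m) j\<bar> \<le> 1 / Suc (\<sigma> m)) \<and> H b i \<le> b i"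
      using hi[OF i] by blast
    from choice[OF this] obtain b where b: "\<And>m. b m \<in> Q"
      "\<And>m j. \<bar>b m j - q (\<sigma> m) j\<bar> \<le> 1 / Suc (\<sigma> m)" "\<And>m. H (b m) i \<le> b m i"
      by blast
    have A: "a \<longlonglongrightarrow> c" using conv[of a] a(2) by simp
    have B: "b \<longlonglongrightarrow> c" using conv[of b] b(2) by simp
    have "c i \<le> H c i"
      using contH[OF i a(1) A] A a(3) by (auto simp: tendsto_fun_iff intro: LIMSEQ_le)
    moreover have "H c i \<le> c i"
      using contH[OF i b(1) B] B b(3) by (auto simp: tendsto_fun_iff intro: LIMSEQ_le)
    ultimately show "H c i = c i" by simp
  qed
qed

section \<open>Schauder's theorem\<close>

text \<open>
  The Schauder projection \<open>y \<mapsto> \<Sum>i. (w i y / W y) *\<^sub>R X i\<close> onto the convex hull of an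
  \<open>\<epsilon>\<close>-net moves points by less than \<open>\<epsilon>\<close>. To apply Brouwer on a cube rather than on a simplex,
  an arbitrary coefficient vector \<open>c\<close> is turned into convex weights \<open>d c\<close>, which agree with
  \<open>c\<close> when \<open>c\<close> already sums to 1.
\<close>

lemma schauder_approximate_fixed_point:
  fixes M :: "'a::real_normed_vector \<Rightarrow> 'a"
  assumes K: "compact K" "convex K" "K \<noteq> {}"
    and M: "continuous_on K M" "M ` K \<subseteq> K" and \<epsilon>: "0 < \<epsilon>"
  shows "\<exists>x\<in>K. norm (M x - x) \<le> \<epsilon>"
proof -
  obtain S where S: "finite S" "S \<subseteq> K" "K \<subseteq> (\<Union>x\<in>S. ball x \<epsilon>)"
    using seq_compact_imp_totally_bounded K(1) \<epsilon> compact_eq_seq_compact_metric by metis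
  obtain n and X :: "nat \<Rightarrow> 'a" where SX: "S = X ` {..<n}"
    using ex_bij_betw_nat_finite[OF S(1)] by (metis atLeast0LessThan bij_betw_imp_surj_on)
  have n: "0 < n" using S(3) K(3) SX by (cases n) auto
  have XK: "X i \<in> K" if "i < n" for i using that S(2) SX by auto
  define Q where "Q = {c :: nat \<Rightarrow> real. \<forall>i. 0 \<le> c i \<and> c i \<le> 1}"
  \<comment> \<open>Missing mass goes to index 0, and a sum above 1 is divided out;
    \<open>max 1\<close> keeps the denominator positive, so \<open>d\<close> is continuous.\<close>
  define d where "d c i = (c i + (if i = 0 then max 0 (1 - sum c {..<n}) else 0)) /
    max 1 (sum c {..<n})" for c :: "nat \<Rightarrow> real" and i
  define v where "v c = (\<Sum>i<n. d c i *\<^sub>R X i)" for c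
  \<comment> \<open>Hat functions around the net points. On \<open>K\<close> at least one is
    positive, so \<open>W\<close> can be a denominator there.\<close>
  define w where "w i y = max 0 (\<epsilon> - dist y (X i))" for i y
  define W where "W y = (\<Sum>i<n. w i y)" for y
  have d0: "0 \<le> d c i" if "c \<in> Q" for c i
    using that by (simp add: Q_def d_def)
  have d1: "(\<Sum>i<n. d c i) = 1" for c
  proof -
    have "(\<Sum>i<n. d c i) = (sum c {..<n} + max 0 (1 - sum c {..<n})) / max 1 (sum c {..<n})"
      using n by (simp add: d_def sum_divide_distrib[symmetric] sum.distrib sum.delta)
    also have "\<dots> = 1" by (auto simp: max_def)
    finally show ?thesis .
  qed
  have vK: "v c \<in> K" if "c \<in> Q" for c
    unfolding v_def using K(2) d1 d0[OF that] XK by (intro convex_sum) auto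
  have W: "0 < W y" if "y \<in> K" for y
  proof -
    have "y \<in> (\<Union>x\<in>S. ball x \<epsilon>)" using S(3) that by blast
    then obtain i where i: "i < n" "dist (X i) y < \<epsilon>" using SX by auto
    have "0 < w i y" using i by (simp add: w_def dist_commute)
    also have "w i y \<le> W y" unfolding W_def using i by (intro member_le_sum) (auto simp: w_def)
    finally show ?thesis .
  qed
  have cv: "continuous_on Q v"
  proof -
    have cc: "continuous_on Q (\<lambda>c. c i)" for i
      by (rule continuous_on_product_then_coordinatewise) (rule continuous_on_id)
    have cd: "continuous_on Q (\<lambda>c. d c i)" for i
      unfolding d_def by (cases "i = 0")
        (auto intro!: continuous_intros cc simp: less_imp_neq[OF less_le_trans[OF zero_less_one max.cobounded1], symmetric])
    show ?thesis
      unfolding v_def by (intro continuous_on_sum continuous_on_scaleR cd continuous_on_const)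
  qed
  have cMv: "continuous_on Q (\<lambda>c. M (v c))"
    using vK by (intro continuous_on_compose2[OF M(1) cv]) auto
  define H where "H c i = w i (M (v c)) / W (M (v c))" for c i
  have MvK: "M (v c) \<in> K" if "c \<in> Q" for c using vK[OF that] M(2) by auto
  have "continuous_on Q (\<lambda>c. H c i)" if "i < n" for i
    unfolding H_def W_def w_def
    using W[OF MvK] by (intro continuous_intros cMv) (force simp: W_def w_def)
  moreover have "0 \<le> H c i \<and> H c i \<le> 1" if "c \<in> Q" "i < n" for c i
  proof -
    have "w i (M (v c)) \<le> W (M (v c))"
      unfolding W_def using that by (intro member_le_sum) (auto simp: w_def)
    then show ?thesis using W[OF MvK[OF that(1)]] by (simp add: H_def w_def)
  qed
  ultimately obtain c where c: "c \<in> Q" "\<And>i. i < n \<Longrightarrow> H c i = c i"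
    using brouwer_cube_fun[of n H, folded Q_def] by blast
  define y where "y = M (v c)"
  \<comment> \<open>The Schauder weights of \<open>y\<close> sum to 1, hence so does the fixed
    vector \<open>c\<close>. Then \<open>d c = c\<close>, and \<open>v c\<close> is the Schauder
    projection of \<open>y\<close>.\<close>
  have "sum c {..<n} = (\<Sum>i<n. w i y / W y)"
    using c(2) by (simp add: H_def y_def)
  also have "\<dots> = 1"
    using W[OF MvK[OF c(1)]] by (simp add: sum_divide_distrib[symmetric] W_def y_def)
  finally have s1: "sum c {..<n} = 1" .
  then have dc: "d c i = c i" for i by (simp add: d_def)
  have "M (v c) - v c = (\<Sum>i<n. c i *\<^sub>R (y - X i))"
    by (simp add: v_def dc s1 scaleR_diff_right sum_subtractf scaleR_sum_left[symmetric] y_def)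
  also have "norm \<dots> \<le> (\<Sum>i<n. c i * \<epsilon>)"
  proof (intro sum_norm_le)
    fix i assume i: "i \<in> {..<n}"
    have ci: "0 \<le> c i" using c(1) by (simp add: Q_def)
    show "norm (c i *\<^sub>R (y - X i)) \<le> c i * \<epsilon>"
    proof (cases "c i = 0")
      case False
      then have "w i y \<noteq> 0" using c(2)[of i] i by (auto simp: H_def y_def)
      then have "norm (y - X i) \<le> \<epsilon>" by (auto simp: w_def dist_norm max_def split: if_splits)
      then show ?thesis using ci by (simp add: mult_left_mono)
    qed simp
  qed
  also have "\<dots> = \<epsilon>" by (simp add: sum_distrib_right[symmetric] s1)
  finally show ?thesis using vK[OF c(1)] by blast
qed

text \<open>By compactness the displacement \<open>norm (M x - x)\<close> attains a minimum, which
  is at most every positive \<open>\<epsilon>\<close> and so is 0.\<close>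

theorem schauder_fixed_point:
  fixes M :: "'a::real_normed_vector \<Rightarrow> 'a"
  assumes K: "compact K" "convex K" "K \<noteq> {}"
    and M: "continuous_on K M" "M ` K \<subseteq> K"
  obtains x where "x \<in> K" "M x = x"
proof -
  have "continuous_on K (\<lambda>x. norm (M x - x))"
    by (intro continuous_intros M)
  then obtain x where x: "x \<in> K" "\<And>y. y \<in> K \<Longrightarrow> norm (M x - x) \<le> norm (M y - y)"
    using continuous_attains_inf[OF K(1,3)] by blast
  have "norm (M x - x) \<le> 0 + \<epsilon>" if "0 < \<epsilon>" for \<epsilon>
    using schauder_approximate_fixed_point[OF K M that] x(2) by fastforce
  then have "norm (M x - x) \<le> 0"
    by (rule field_le_epsilon)
  then show thesis using x(1) that by simp
qed

section \<open>The fractional integral and its inversion\<close>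

lemma borel_measurable_apply_bcontfun [measurable]:
  "apply_bcontfun w \<in> borel_measurable borel"
  by (intro borel_measurable_continuous_onI) simp

text \<open>Based on \<open>lborel\<close>, so that Fubini's theorem applies to Borel integrands;
  the \<open>lebesgue\<close> integrals of \<open>RL_kernel_integral\<close> are reached by
  completion.\<close>

definition RL_integral :: "real \<Rightarrow> (real \<Rightarrow> real) \<Rightarrow> real \<Rightarrow> real" where
  "RL_integral \<alpha> w t = 1 / Gamma \<alpha> * (LINT s:{0..t}|lborel. (t - s) powr (\<alpha> - 1) * w s)"

text \<open>For a nonnegative function gauge integrability is absolute integrability, and Borel
  measurability leads from \<open>lebesgue\<close> down to \<open>lborel\<close>.\<close>

lemma has_bochner_integral_lborel_of_has_integral:
  fixes f :: "real \<Rightarrow> real"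
  assumes f: "f \<in> borel_measurable borel" and S: "S \<in> sets borel"
    and nonneg: "\<And>x. x \<in> S \<Longrightarrow> 0 \<le> f x" and I: "(f has_integral I) S"
  shows "has_bochner_integral lborel (\<lambda>x. indicator S x * f x) I"
proof -
  have "f absolutely_integrable_on S"
    using nonneg I by (subst absolutely_integrable_on_iff_nonneg) auto
  then have "integrable lebesgue (\<lambda>x. indicator S x * f x)"
    by (simp add: set_integrable_def)
  then have int: "integrable lborel (\<lambda>x. indicator S x * f x)"
    using f S by (subst (asm) integrable_completion) auto
  then have "set_integrable lborel S f"
    by (simp add: set_integrable_def)
  from set_borel_integral_eq_integral(2)[OF this] have "(LINT x:S|lborel. f x) = I"
    using I by (simp add: integral_unique)
  then show ?thesis
    using int by (simp add: has_bochner_integral_iff set_lebesgue_integral_def)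
qed

text \<open>The antiderivative \<open>- ((t - s) powr \<alpha> / \<alpha>)\<close> is continuous up
  to \<open>s = t\<close>, where the kernel may be singular, so derivatives in the interior
  suffice.\<close>

lemma has_bochner_integral_powr_kernel:
  fixes a b t \<alpha> :: real
  assumes \<alpha>: "0 < \<alpha>" and abt: "a \<le> b" "b \<le> t"
  shows "has_bochner_integral lborel (\<lambda>s. indicator {a..b} s * (t - s) powr (\<alpha> - 1))
           (((t - a) powr \<alpha> - (t - b) powr \<alpha>) / \<alpha>)"
proof (rule has_bochner_integral_lborel_of_has_integral)
  have "((\<lambda>s. (t - s) powr (\<alpha> - 1)) has_integral
      (- ((t - b) powr \<alpha> / \<alpha>)) - (- ((t - a) powr \<alpha> / \<alpha>))) {a..b}"
  proof (rule fundamental_theorem_of_calculus_interior[OF abt(1)])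
    show "continuous_on {a..b} (\<lambda>s. - ((t - s) powr \<alpha> / \<alpha>))"
      using \<alpha> abt
      by (intro continuous_on_minus continuous_on_divide continuous_on_powr' continuous_on_diff
          continuous_on_const continuous_on_id) auto
    fix s assume s: "s \<in> {a<..<b}"
    show "((\<lambda>s. - ((t - s) powr \<alpha> / \<alpha>)) has_vector_derivative (t - s) powr (\<alpha> - 1)) (at s)"
      unfolding has_real_derivative_iff_has_vector_derivative[symmetric]
      using \<alpha> s abt by (auto intro!: derivative_eq_intros simp: powr_diff)
  qed
  then show "((\<lambda>s. (t - s) powr (\<alpha> - 1)) has_integral
      ((t - a) powr \<alpha> - (t - b) powr \<alpha>) / \<alpha>) {a..b}"
    by (simp add: diff_divide_distrib)
qed auto

text \<open>The substitution \<open>s = \<tau> + d * x\<close> with \<open>d = t - \<tau>\<close>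
  leads to \<open>Beta \<alpha> (1 - \<alpha>)\<close>: the powers of \<open>d\<close> multiply to
  \<open>1 / d\<close>, which the Jacobian cancels.\<close>

lemma has_bochner_integral_Beta_kernel:
  fixes \<alpha> \<tau> t :: real
  assumes \<alpha>: "0 < \<alpha>" "\<alpha> < 1" and \<tau>: "\<tau> < t"
  shows "has_bochner_integral lborel
           (\<lambda>s. indicator {\<tau>..t} s * ((s - \<tau>) powr (\<alpha> - 1) * (t - s) powr (- \<alpha>)))
           (Gamma \<alpha> * Gamma (1 - \<alpha>))"
proof -
  define F where "F s = indicator {\<tau>..t} s * ((s - \<tau>) powr (\<alpha> - 1) * (t - s) powr (- \<alpha>))" for s
  define d where "d = t - \<tau>"
  have d: "0 < d" using \<tau> by (simp add: d_def)
  have beta: "has_bochner_integral lborel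
      (\<lambda>x. indicator {0..1} x * (x powr (\<alpha> - 1) * (1 - x) powr ((1 - \<alpha>) - 1))) (Beta \<alpha> (1 - \<alpha>))"
    using \<alpha> by (intro has_bochner_integral_lborel_of_has_integral has_integral_Beta_real) auto
  have F: "F (\<tau> + d * x) = indicator {0..1} x * (x powr (\<alpha> - 1) * (1 - x) powr ((1 - \<alpha>) - 1)) / d" for x
  proof (cases "x \<in> {0..1}")
    case True
    have "d * x \<le> d" using True d by (simp add: mult_left_le)
    moreover have "t = \<tau> + d" by (simp add: d_def)
    ultimately have "\<tau> + d * x \<in> {\<tau>..t}" using True d by simp
    moreover have "t - (\<tau> + d * x) = d * (1 - x)" by (simp add: d_def algebra_simps)
    moreover have "d powr (\<alpha> - 1) * d powr (- \<alpha>) = 1 / d"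
      using d by (simp add: powr_diff powr_minus_divide)
    ultimately show ?thesis
      using True d by (simp add: F_def powr_mult) (simp add: field_simps)
  next
    case False
    then have "d * x < 0 \<or> d < d * x" using d by (auto simp: mult_less_0_iff)
    then have "\<tau> + d * x \<notin> {\<tau>..t}" by (auto simp: d_def)
    then show ?thesis using False by (simp add: F_def)
  qed
  have "has_bochner_integral lborel (\<lambda>x. F (\<tau> + d * x)) (Beta \<alpha> (1 - \<alpha>) / d)"
    unfolding F using has_bochner_integral_divide_zero[OF beta, of d] by simp
  then have "has_bochner_integral lborel F (Beta \<alpha> (1 - \<alpha>))"
    using d by (subst lborel_has_bochner_integral_real_affine_iff[of d _ _ \<tau>]) (simp_all add: divide_inverse mult.commute)
  then show ?thesis
    using \<alpha> by (simp add: F_def[abs_def] Beta_def)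
qed

section \<open>Estimates for the fractional integral\<close>

context
  fixes \<alpha> :: real
  assumes \<alpha>: "0 < \<alpha>"
begin

lemma Gamma_plus1_pos: "Gamma (\<alpha> + 1) = \<alpha> * Gamma \<alpha>"
  using \<alpha> by (intro Gamma_plus1) (auto elim: nonpos_Ints_cases)

text \<open>The integrand is dominated by \<open>norm w\<close> times the kernel, whose integral is
  known.\<close>

lemma powr_kernel_bcontfun:
  fixes w :: "real \<Rightarrow>\<^sub>C real"
  assumes abt: "a \<le> b" "b \<le> t"
  shows "set_integrable lborel {a..b} (\<lambda>s. (t - s) powr (\<alpha> - 1) * w s)" (is ?int)
    and "\<bar>LINT s:{a..b}|lborel. (t - s) powr (\<alpha> - 1) * w s\<bar>
           \<le> norm w * (((t - a) powr \<alpha> - (t - b) powr \<alpha>) / \<alpha>)" (is ?bound)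
proof -
  note k = has_bochner_integral_powr_kernel[OF \<alpha> abt]
  have kw: "has_bochner_integral lborel (\<lambda>s. norm w * (indicator {a..b} s * (t - s) powr (\<alpha> - 1)))
      (norm w * (((t - a) powr \<alpha> - (t - b) powr \<alpha>) / \<alpha>))"
    by (rule has_bochner_integral_mult_right) (rule k)
  have le: "norm (indicator {a..b} s *\<^sub>R ((t - s) powr (\<alpha> - 1) * w s))
      \<le> norm w * (indicator {a..b} s * (t - s) powr (\<alpha> - 1))" for s
    using norm_bounded[of w s] by (auto simp: indicator_def abs_mult mult.commute intro: mult_right_mono)
  show ?int
    unfolding set_integrable_def
    by (rule Bochner_Integration.integrable_bound[OF integrable.intros[OF kw]])
      (use le in \<open>auto intro!: AE_I2 order_trans[OF le]\<close>)
  show ?bound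
    unfolding set_lebesgue_integral_def real_norm_def[symmetric]
      has_bochner_integral_integral_eq[OF kw, symmetric]
    by (rule Bochner_Integration.integral_norm_bound_integral[OF \<open>?int\<close>[unfolded set_integrable_def] integrable.intros[OF kw] le])
qed

lemma RL_integral_diff:
  fixes v w :: "real \<Rightarrow>\<^sub>C real"
  assumes "0 \<le> t"
  shows "RL_integral \<alpha> v t - RL_integral \<alpha> w t = RL_integral \<alpha> (v - w) t"
proof -
  have "(LINT s:{0..t}|lborel. (t - s) powr (\<alpha> - 1) * (v - w) s) =
    (LINT s:{0..t}|lborel. (t - s) powr (\<alpha> - 1) * v s) -
    (LINT s:{0..t}|lborel. (t - s) powr (\<alpha> - 1) * w s)"
    by (subst set_integral_diff(2)[symmetric])
      (use assms in \<open>simp_all add: powr_kernel_bcontfun right_diff_distrib\<close>)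
  then show ?thesis by (simp add: RL_integral_def right_diff_distrib diff_divide_distrib)
qed

lemma abs_RL_integral_le:
  fixes w :: "real \<Rightarrow>\<^sub>C real"
  assumes "0 \<le> t"
  shows "\<bar>RL_integral \<alpha> w t\<bar> \<le> norm w * t powr \<alpha> / Gamma (\<alpha> + 1)"
proof -
  have G: "0 < Gamma \<alpha>" using \<alpha> by (rule Gamma_real_pos)
  have "\<bar>RL_integral \<alpha> w t\<bar> \<le> 1 / Gamma \<alpha> * (norm w * (t powr \<alpha> / \<alpha>))"
    unfolding RL_integral_def abs_mult
    using powr_kernel_bcontfun(2)[of 0 t t w] assms \<alpha> G by (intro mult_mono) auto
  then show ?thesis using \<alpha> by (simp add: Gamma_plus1_pos mult.commute)
qed

text \<open>Splitting at \<open>s\<close> leaves the integral over \<open>{s..t}\<close> and a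
  difference of kernels over \<open>{0..s}\<close>. As \<open>\<alpha> \<le> 1\<close>, that
  difference has constant sign, and its absolute value integrates to \<open>(s powr \<alpha> - t
  powr \<alpha> + (t - s) powr \<alpha>) / \<alpha>\<close>. Each part contributes at most
  \<open>norm w * ((t - s) powr \<alpha> / \<alpha>)\<close>, hence the factor 2.\<close>

lemma RL_integral_Hoelder:
  fixes w :: "real \<Rightarrow>\<^sub>C real"
  assumes \<alpha>1: "\<alpha> \<le> 1" and st: "0 \<le> s" "s \<le> t"
  shows "\<bar>RL_integral \<alpha> w t - RL_integral \<alpha> w s\<bar> \<le> 2 * norm w / Gamma (\<alpha> + 1) * (t - s) powr \<alpha>"
proof -
  have G: "0 < Gamma \<alpha>" using \<alpha> by (rule Gamma_real_pos)
  define I where "I a b u = (LINT \<tau>:{a..b}|lborel. (u - \<tau>) powr (\<alpha> - 1) * w \<tau>)" for a b u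
  have split: "I 0 t t = I 0 s t + I s t t"
  proof -
    have "I 0 t t = (LINT \<tau>:{0..s} \<union> {s<..t}|lborel. (t - \<tau>) powr (\<alpha> - 1) * w \<tau>)"
      using st by (simp add: I_def ivl_disj_un_two_touch ivl_disj_un)
    also have "\<dots> = I 0 s t + (LINT \<tau>:{s<..t}|lborel. (t - \<tau>) powr (\<alpha> - 1) * w \<tau>)"
      unfolding I_def using st
      by (intro set_integral_Un set_integrable_subset[OF powr_kernel_bcontfun(1)[of s t t]] powr_kernel_bcontfun) auto
    also have "(LINT \<tau>:{s<..t}|lborel. (t - \<tau>) powr (\<alpha> - 1) * w \<tau>) = I s t t"
      unfolding I_def set_lebesgue_integral_def
      by (rule integral_cong_AE, measurable)
        (rule eventually_mono[OF AE_lborel_singleton[of s]], auto simp: indicator_def)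
    finally show ?thesis .
  qed
  let ?k = "\<lambda>u \<tau>. indicator {0..s} \<tau> * (u - \<tau>) powr (\<alpha> - 1) :: real"
  have ks: "has_bochner_integral lborel (?k s) (s powr \<alpha> / \<alpha>)"
    and kt: "has_bochner_integral lborel (?k t) ((t powr \<alpha> - (t - s) powr \<alpha>) / \<alpha>)"
    using has_bochner_integral_powr_kernel[OF \<alpha> st(1), of s] has_bochner_integral_powr_kernel[OF \<alpha> st] \<alpha>
    by simp_all
  have D: "has_bochner_integral lborel (\<lambda>\<tau>. norm w * (?k s \<tau> - ?k t \<tau>))
      (norm w * (s powr \<alpha> / \<alpha> - (t powr \<alpha> - (t - s) powr \<alpha>) / \<alpha>))"
    by (intro has_bochner_integral_mult_right has_bochner_integral_diff ks kt)
  define E where "E \<tau> = ?k t \<tau> * w \<tau> - ?k s \<tau> * w \<tau>" for \<tau>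
  have ints: "integrable lborel (\<lambda>\<tau>. ?k s \<tau> * w \<tau>)" "integrable lborel (\<lambda>\<tau>. ?k t \<tau> * w \<tau>)"
    using powr_kernel_bcontfun(1)[of 0 s s w] powr_kernel_bcontfun(1)[of 0 s t w] st
    by (simp_all add: set_integrable_def mult.assoc)
  have "I 0 s t - I 0 s s = integral\<^sup>L lborel E"
    unfolding I_def set_lebesgue_integral_def E_def using ints
    by (subst Bochner_Integration.integral_diff) (simp_all add: mult.assoc)
  also have "\<bar>integral\<^sup>L lborel E\<bar> \<le> (\<integral>\<tau>. \<bar>E \<tau>\<bar> \<partial>lborel)"
    by (rule integral_abs_bound)
  also have "\<dots> \<le> (\<integral>\<tau>. norm w * (?k s \<tau> - ?k t \<tau>) \<partial>lborel)"
  proof (rule integral_mono_AE)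
    show "integrable lborel (\<lambda>\<tau>. \<bar>E \<tau>\<bar>)"
      unfolding E_def using ints by (intro integrable_abs Bochner_Integration.integrable_diff)
    show "integrable lborel (\<lambda>\<tau>. norm w * (?k s \<tau> - ?k t \<tau>))"
      using D by (rule integrable.intros)
    \<comment> \<open>At \<open>\<tau> = s\<close> the kernel \<open>?k s\<close> takes the value
      \<open>0 powr (\<alpha> - 1) = 0\<close> and the bound can fail; this null set is left
      out.\<close>
    have "\<bar>E \<tau>\<bar> \<le> norm w * (?k s \<tau> - ?k t \<tau>)" if "\<tau> \<noteq> s" for \<tau>
    proof (cases "\<tau> \<in> {0..s}")
      case True
      then have "(t - \<tau>) powr (\<alpha> - 1) \<le> (s - \<tau>) powr (\<alpha> - 1)"
        using that st \<alpha>1 by (intro powr_mono2') auto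
      moreover have "\<bar>E \<tau>\<bar> = \<bar>w \<tau>\<bar> * \<bar>(t - \<tau>) powr (\<alpha> - 1) - (s - \<tau>) powr (\<alpha> - 1)\<bar>"
        using True by (simp add: E_def left_diff_distrib[symmetric] abs_mult)
      moreover have "\<bar>w \<tau>\<bar> \<le> norm w" using norm_bounded[of w \<tau>] by simp
      ultimately show ?thesis using True by (simp add: mult_right_mono)
    qed (simp add: E_def)
    then show "AE \<tau> in lborel. \<bar>E \<tau>\<bar> \<le> norm w * (?k s \<tau> - ?k t \<tau>)"
      by (intro eventually_mono[OF AE_lborel_singleton[of s]])
  qed
  also have "\<dots> = norm w * ((s powr \<alpha> - t powr \<alpha> + (t - s) powr \<alpha>) / \<alpha>)"
    unfolding has_bochner_integral_integral_eq[OF D] by (simp add: diff_divide_distrib add_divide_distrib)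
  also have "\<dots> \<le> norm w * ((t - s) powr \<alpha> / \<alpha>)"
    using st \<alpha> powr_mono2[of \<alpha> s t] by (intro mult_left_mono divide_right_mono) auto
  finally have 1: "\<bar>I 0 s t - I 0 s s\<bar> \<le> norm w * ((t - s) powr \<alpha> / \<alpha>)" .
  have 2: "\<bar>I s t t\<bar> \<le> norm w * ((t - s) powr \<alpha> / \<alpha>)"
    using powr_kernel_bcontfun(2)[of s t t w] st \<alpha> by (simp add: I_def)
  have "RL_integral \<alpha> w t - RL_integral \<alpha> w s = 1 / Gamma \<alpha> * ((I 0 s t - I 0 s s) + I s t t)"
    unfolding RL_integral_def I_def[symmetric] split by (simp add: diff_divide_distrib add_divide_distrib)
  also have "\<bar>\<dots>\<bar> \<le> 1 / Gamma \<alpha> * (2 * (norm w * ((t - s) powr \<alpha> / \<alpha>)))"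
    unfolding abs_mult using 1 2 G by (intro mult_mono) auto
  also have "\<dots> = 2 * norm w / Gamma (\<alpha> + 1) * (t - s) powr \<alpha>"
    using \<alpha> by (simp add: Gamma_plus1_pos mult.commute)
  finally show ?thesis .
qed

section \<open>Abel's inversion and the fractional derivative\<close>

text \<open>
  Abel's inversion: exchanging the order of integration leaves, for each \<open>\<tau>\<close>, the Beta integral
  \<open>\<integral>\<^bsub>\<tau>\<^esub>\<^bsup>t\<^esup> (s - \<tau>)\<^bsup>\<alpha>-1\<^esup> (t - s)\<^bsup>-\<alpha>\<^esup> ds = \<Gamma>(\<alpha>) \<Gamma>(1 - \<alpha>)\<close>, independently of \<open>\<tau>\<close>.
\<close>

lemma RL_integral_Abel:
  fixes w :: "real \<Rightarrow>\<^sub>C real"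
  assumes \<alpha>1: "\<alpha> < 1" and t: "0 \<le> t"
  shows "has_bochner_integral lborel (\<lambda>s. indicator {0..t} s * (RL_integral \<alpha> w s / (t - s) powr \<alpha>))
           (Gamma (1 - \<alpha>) * (LINT s:{0..t}|lborel. w s))"
proof -
  have G: "0 < Gamma \<alpha>" "0 < Gamma (1 - \<alpha>)" using \<alpha> \<alpha>1 by (auto intro: Gamma_real_pos)
  \<comment> \<open>The integrand on the triangle \<open>0 \<le> \<tau> \<le> s \<le> t\<close>. The
    null set \<open>\<tau> = t\<close> is excluded because the Beta integral needs
    \<open>\<tau> < t\<close>.\<close>
  define F where "F \<tau> s = (if 0 \<le> \<tau> \<and> \<tau> < t \<and> \<tau> \<le> s \<and> s \<le> t
    then w \<tau> * ((s - \<tau>) powr (\<alpha> - 1) * (t - s) powr (- \<alpha>)) else 0)" for \<tau> s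
  define C where "C = Gamma \<alpha> * Gamma (1 - \<alpha>)"
  have Fs: "has_bochner_integral lborel (F \<tau>) (indicator {0..<t} \<tau> * w \<tau> * C)"
    and Fs': "has_bochner_integral lborel (\<lambda>s. norm (F \<tau> s)) (indicator {0..<t} \<tau> * \<bar>w \<tau>\<bar> * C)" for \<tau>
  proof -
    have "has_bochner_integral lborel (F \<tau>) (indicator {0..<t} \<tau> * w \<tau> * C) \<and>
      has_bochner_integral lborel (\<lambda>s. norm (F \<tau> s)) (indicator {0..<t} \<tau> * \<bar>w \<tau>\<bar> * C)"
    proof (cases "\<tau> \<in> {0..<t}")
      case True
      then have b: "has_bochner_integral lborel
           (\<lambda>s. indicator {\<tau>..t} s * ((s - \<tau>) powr (\<alpha> - 1) * (t - s) powr (- \<alpha>))) C"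
        using has_bochner_integral_Beta_kernel[OF \<alpha> \<alpha>1] by (simp add: C_def)
      have "F \<tau> = (\<lambda>s. w \<tau> * (indicator {\<tau>..t} s * ((s - \<tau>) powr (\<alpha> - 1) * (t - s) powr (- \<alpha>))))"
        "(\<lambda>s. norm (F \<tau> s)) = (\<lambda>s. \<bar>w \<tau>\<bar> * (indicator {\<tau>..t} s * ((s - \<tau>) powr (\<alpha> - 1) * (t - s) powr (- \<alpha>))))"
        using True by (auto simp: F_def fun_eq_iff abs_mult)
      then show ?thesis
        using has_bochner_integral_mult_right[OF b, of "w \<tau>"]
          has_bochner_integral_mult_right[OF b, of "\<bar>w \<tau>\<bar>"] True by simp
    next
      case False
      then have "F \<tau> = (\<lambda>s. 0)" by (auto simp: F_def)
      then show ?thesis using False by (simp add: has_bochner_integral_zero)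
    qed
    then show "has_bochner_integral lborel (F \<tau>) (indicator {0..<t} \<tau> * w \<tau> * C)"
      and "has_bochner_integral lborel (\<lambda>s. norm (F \<tau> s)) (indicator {0..<t} \<tau> * \<bar>w \<tau>\<bar> * C)"
      by auto
  qed
  have wint: "set_integrable lborel {0..t} (\<lambda>s. w s)"
    unfolding set_integrable_def by (rule borel_integrable_compact) auto
  \<comment> \<open>Integrating the norm over \<open>s\<close> first leaves
    \<open>\<bar>w \<tau>\<bar> * C\<close> on \<open>{0..<t}\<close>, which is integrable.\<close>
  have F: "integrable (lborel \<Otimes>\<^sub>M lborel) (case_prod F)"
  proof (rule lborel_pair.Fubini_integrable)
    show "case_prod F \<in> borel_measurable (lborel \<Otimes>\<^sub>M lborel)"
      unfolding F_def by measurable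
    have "integrable lborel (\<lambda>\<tau>. indicator {0..<t} \<tau> *\<^sub>R \<bar>w \<tau>\<bar>)"
      unfolding set_integrable_def[symmetric]
      by (rule set_integrable_subset[OF set_integrable_abs[OF wint]]) auto
    then show "integrable lborel (\<lambda>\<tau>. \<integral>s. norm (case_prod F (\<tau>, s)) \<partial>lborel)"
      using has_bochner_integral_integral_eq[OF Fs'] by simp
    show "AE \<tau> in lborel. integrable lborel (\<lambda>s. case_prod F (\<tau>, s))"
      using integrable.intros[OF Fs] by simp
  qed
  have inner: "(\<integral>\<tau>. F \<tau> s \<partial>lborel) = Gamma \<alpha> * (indicator {0..t} s * (RL_integral \<alpha> w s / (t - s) powr \<alpha>))" for s
  proof (cases "s \<in> {0..<t}")
    case True
    then have "F \<tau> s = (indicator {0..s} \<tau> *\<^sub>R ((s - \<tau>) powr (\<alpha> - 1) * w \<tau>)) * (t - s) powr (- \<alpha>)" for \<tau>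
      by (auto simp: F_def indicator_def)
    then have "(\<integral>\<tau>. F \<tau> s \<partial>lborel) = (LINT \<tau>:{0..s}|lborel. (s - \<tau>) powr (\<alpha> - 1) * w \<tau>) * (t - s) powr (- \<alpha>)"
      by (simp add: set_lebesgue_integral_def)
    then show ?thesis using True G by (simp add: RL_integral_def powr_minus divide_inverse)
  next
    \<comment> \<open>At \<open>s = t\<close> both sides vanish: \<open>0 powr (- \<alpha>)\<close>
      is 0, and so is division by \<open>0 powr \<alpha>\<close>.\<close>
    case False
    then have "F \<tau> s = 0" for \<tau> by (auto simp: F_def)
    then show ?thesis using False by (auto simp: indicator_def)
  qed
  have "integrable lborel (\<lambda>s. \<integral>\<tau>. F \<tau> s \<partial>lborel)"
    by (rule lborel_pair.integrable_snd[OF F])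
  then have "integrable lborel (\<lambda>s. 1 / Gamma \<alpha> * (\<integral>\<tau>. F \<tau> s \<partial>lborel))"
    by (rule integrable_mult_right)
  then have int: "integrable lborel (\<lambda>s. indicator {0..t} s * (RL_integral \<alpha> w s / (t - s) powr \<alpha>))"
    unfolding inner using G by simp
  have "(\<integral>s. (\<integral>\<tau>. F \<tau> s \<partial>lborel) \<partial>lborel) = (\<integral>\<tau>. (\<integral>s. F \<tau> s \<partial>lborel) \<partial>lborel)"
    by (rule lborel_pair.Fubini_integral[OF F])
  also have "\<dots> = (\<integral>\<tau>. indicator {0..<t} \<tau> * w \<tau> \<partial>lborel) * C"
    by (simp add: has_bochner_integral_integral_eq[OF Fs])
  also have "(\<integral>\<tau>. indicator {0..<t} \<tau> * w \<tau> \<partial>lborel) = (LINT s:{0..t}|lborel. w s)"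
    unfolding set_lebesgue_integral_def
    by (rule integral_cong_AE, measurable)
      (rule eventually_mono[OF AE_lborel_singleton[of t]], auto simp: indicator_def)
  finally have "(\<integral>s. indicator {0..t} s * (RL_integral \<alpha> w s / (t - s) powr \<alpha>) \<partial>lborel)
      = Gamma (1 - \<alpha>) * (LINT s:{0..t}|lborel. w s)"
    unfolding inner integral_mult_right_zero C_def using G by (simp only: mult_ac mult_left_cancel[OF less_imp_neq[OF G(1), symmetric]])
  with int show ?thesis by (simp add: has_bochner_integral_iff)
qed

text \<open>By Abel's inversion the kernel integral of \<open>u\<close> near \<open>t\<close> is
  \<open>Gamma (1 - \<alpha>)\<close> times the ordinary integral of \<open>w\<close>. The
  fundamental theorem of calculus differentiates it, and the constant cancels against the one in
  \<open>RL_derivative\<close>.\<close>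

lemma RL_derivative_RL_integral:
  fixes w :: "real \<Rightarrow>\<^sub>C real"
  assumes \<alpha>1: "\<alpha> < 1" and u: "\<And>s. s \<in> {0..1} \<Longrightarrow> u s = RL_integral \<alpha> w s"
    and t: "t \<in> {0<..<1}"
  shows "RL_differentiable \<alpha> u t" and "RL_derivative \<alpha> u t = w t"
proof -
  have G: "0 < Gamma (1 - \<alpha>)" using \<alpha>1 by (auto intro: Gamma_real_pos)
  \<comment> \<open>\<open>u\<close> is known on \<open>{0..1}\<close> only, so the upper limits are
    kept inside the unit interval.\<close>
  have near: "\<forall>\<^sub>F \<tau> in nhds t. \<tau> \<in> {0<..<1}"
    using t by (intro eventually_nhds_in_open) auto
  have kernel: "has_bochner_integral lebesgue (\<lambda>s. indicator {0..\<tau>} s *\<^sub>R (u s / (\<tau> - s) powr \<alpha>))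
      (Gamma (1 - \<alpha>) * integral {0..\<tau>} (apply_bcontfun w))" if \<tau>: "\<tau> \<in> {0<..<1}" for \<tau>
  proof -
    have eq: "(\<lambda>s. indicator {0..\<tau>} s *\<^sub>R (u s / (\<tau> - s) powr \<alpha>)) =
      (\<lambda>s. indicator {0..\<tau>} s * (RL_integral \<alpha> w s / (\<tau> - s) powr \<alpha>))"
      using \<tau> by (auto simp: fun_eq_iff u indicator_def)
    have "set_integrable lborel {0..\<tau>} (\<lambda>s. w s)"
      unfolding set_integrable_def by (rule borel_integrable_compact) auto
    from set_borel_integral_eq_integral(2)[OF this]
    have b: "has_bochner_integral lborel (\<lambda>s. indicator {0..\<tau>} s * (RL_integral \<alpha> w s / (\<tau> - s) powr \<alpha>))
      (Gamma (1 - \<alpha>) * integral {0..\<tau>} (apply_bcontfun w))"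
      using RL_integral_Abel[OF \<alpha>1, of \<tau> w] \<tau> by simp
    moreover have "(\<lambda>s. indicator {0..\<tau>} s * (RL_integral \<alpha> w s / (\<tau> - s) powr \<alpha>)) \<in> borel_measurable lborel"
      using b by (rule borel_measurable_has_bochner_integral)
    ultimately show ?thesis
      unfolding eq by (simp add: has_bochner_integral_iff integrable_completion integral_completion)
  qed
  have "(RL_kernel_integral \<alpha> u has_field_derivative Gamma (1 - \<alpha>) * w t) (at t)"
  proof (rule DERIV_cong_ev[OF refl _ refl, THEN iffD2])
    show "\<forall>\<^sub>F \<tau> in nhds t. RL_kernel_integral \<alpha> u \<tau> = Gamma (1 - \<alpha>) * integral {0..\<tau>} (apply_bcontfun w)"
      using near by eventually_elim
        (simp add: RL_kernel_integral_def set_lebesgue_integral_def has_bochner_integral_integral_eq[OF kernel, simplified])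
    have "((\<lambda>\<tau>. integral {0..\<tau>} (apply_bcontfun w)) has_real_derivative w t) (at t within {0..1})"
      using t by (intro integral_has_real_derivative) auto
    then have "((\<lambda>\<tau>. integral {0..\<tau>} (apply_bcontfun w)) has_real_derivative w t) (at t)"
      using t by (simp add: at_within_Icc_at)
    then show "((\<lambda>\<tau>. Gamma (1 - \<alpha>) * integral {0..\<tau>} (apply_bcontfun w)) has_real_derivative Gamma (1 - \<alpha>) * w t) (at t)"
      by (rule DERIV_cmult)
  qed
  then show "RL_derivative \<alpha> u t = w t" and "RL_differentiable \<alpha> u t"
    using G eventually_mono[OF near integrable.intros[OF kernel]]
    unfolding RL_derivative_def RL_differentiable_def set_integrable_def
    by (auto simp: DERIV_imp_deriv real_differentiable_def)
qed

end

section \<open>Operators on bounded continuous functions\<close>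

text \<open>
  Functions on \<open>[0,1]\<close> are extended to the whole line as \<open>u \<circ> clip\<close>, so that \<open>C[0,1]\<close>
  becomes a subspace of the Banach space \<open>real \<Rightarrow>\<^sub>C real\<close>.
\<close>

definition clip :: "real \<Rightarrow> real" where
  "clip t = max 0 (min 1 t)"

lemma clip_mem: "clip t \<in> {0..1}"
  and clip_eq: "t \<in> {0..1} \<Longrightarrow> clip t = t"
  and clip_clip: "clip (clip t) = clip t"
  and abs_clip_diff_le: "\<bar>clip s - clip t\<bar> \<le> \<bar>s - t\<bar>"
  by (auto simp: clip_def)

lemma continuous_on_clip: "continuous_on A clip"
  unfolding clip_def[abs_def] by (intro continuous_intros)

lemma clip_comp_bcontfun:
  fixes u :: "real \<Rightarrow> real"
  assumes "continuous_on {0..1} u"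
  shows "(\<lambda>t. u (clip t)) \<in> bcontfun"
proof -
  have "continuous_on UNIV (\<lambda>t. u (clip t))"
    using clip_mem by (intro continuous_on_compose2[OF assms continuous_on_clip]) auto
  moreover have "bounded (u ` {0..1})"
    using assms by (intro compact_imp_bounded compact_continuous_image) auto
  then have "bounded (range (\<lambda>t. u (clip t)))"
    by (rule bounded_subset) (use clip_mem in auto)
  ultimately show ?thesis by (simp add: bcontfun_def)
qed

text \<open>Convexity of \<open>exp\<close> between 0 and \<open>ln (d + 1)\<close>. It turns the
  growth conditions on the nonlinearities into Lipschitz conditions with constants below 1.\<close>

lemma powr_add_one_le:
  fixes d k :: real
  assumes "0 \<le> d" "0 \<le> k" "k \<le> 1"
  shows "(d + 1) powr k - 1 \<le> k * d"
proof -
  have "exp ((1 - k) *\<^sub>R 0 + k *\<^sub>R ln (d + 1)) \<le> (1 - k) * exp 0 + k * exp (ln (d + 1))"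
    using assms by (intro convex_onD[OF exp_convex]) auto
  then show ?thesis using assms by (simp add: powr_def algebra_simps)
qed

section \<open>Compact convex sets of Hoelder continuous functions\<close>

lemma Hoelder_modulus:
  fixes C \<alpha> e :: real
  assumes "0 < \<alpha>" "0 \<le> C" "0 < e"
  obtains d where "0 < d" "\<And>s t. \<bar>s - t\<bar> < d \<Longrightarrow> C * \<bar>s - t\<bar> powr \<alpha> < e"
proof
  \<comment> \<open>Dividing by \<open>C + 1\<close> instead of \<open>C\<close> covers
    \<open>C = 0\<close> and makes the final inequality strict.\<close>
  show "0 < (e / (C + 1)) powr (1 / \<alpha>)" using assms by simp
  fix s t :: real assume "\<bar>s - t\<bar> < (e / (C + 1)) powr (1 / \<alpha>)"
  then have "\<bar>s - t\<bar> powr \<alpha> \<le> ((e / (C + 1)) powr (1 / \<alpha>)) powr \<alpha>"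
    using assms by (intro powr_mono2) auto
  also have "\<dots> = e / (C + 1)" using assms by (simp add: powr_powr)
  finally have "C * \<bar>s - t\<bar> powr \<alpha> \<le> C * (e / (C + 1))"
    using assms by (intro mult_left_mono)
  also have "\<dots> < e" using assms by (simp add: field_simps)
  finally show "C * \<bar>s - t\<bar> powr \<alpha> < e" .
qed

text \<open>The last condition makes \<open>h\<close> constant on either side of
  \<open>{0..1}\<close>; this lets uniform convergence on the interval extend to the line.\<close>

definition Hoelder_set :: "real \<Rightarrow> real \<Rightarrow> real \<Rightarrow> (real \<Rightarrow>\<^sub>C real) set" where
  "Hoelder_set \<alpha> B C = {h. norm h \<le> B \<and>
     (\<forall>s t. \<bar>apply_bcontfun h s - apply_bcontfun h t\<bar> \<le> C * \<bar>s - t\<bar> powr \<alpha>) \<and>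
     (\<forall>t. apply_bcontfun h t = apply_bcontfun h (clip t))}"

lemma convex_Hoelder_set: "convex (Hoelder_set \<alpha> B C)"
proof (rule convexI)
  fix h1 h2 :: "real \<Rightarrow>\<^sub>C real" and u v :: real
  assume h: "h1 \<in> Hoelder_set \<alpha> B C" "h2 \<in> Hoelder_set \<alpha> B C" and uv: "0 \<le> u" "0 \<le> v" "u + v = 1"
  have "u *\<^sub>R h1 + v *\<^sub>R h2 \<in> cball 0 B"
    using h uv by (intro convexD[OF convex_cball]) (auto simp: Hoelder_set_def)
  moreover have "\<bar>(u *\<^sub>R h1 + v *\<^sub>R h2) s - (u *\<^sub>R h1 + v *\<^sub>R h2) t\<bar> \<le> C * \<bar>s - t\<bar> powr \<alpha>" for s t
  proof -
    have "(u *\<^sub>R h1 + v *\<^sub>R h2) s - (u *\<^sub>R h1 + v *\<^sub>R h2) t = u * (h1 s - h1 t) + v * (h2 s - h2 t)"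
      by (simp add: algebra_simps)
    also have "\<bar>\<dots>\<bar> \<le> u * \<bar>h1 s - h1 t\<bar> + v * \<bar>h2 s - h2 t\<bar>"
      using uv abs_triangle_ineq[of "u * (h1 s - h1 t)" "v * (h2 s - h2 t)"] by (simp add: abs_mult)
    also have "\<dots> \<le> u * (C * \<bar>s - t\<bar> powr \<alpha>) + v * (C * \<bar>s - t\<bar> powr \<alpha>)"
      using h uv by (intro add_mono mult_left_mono) (auto simp: Hoelder_set_def)
    also have "\<dots> = C * \<bar>s - t\<bar> powr \<alpha>"
      using uv by (simp add: distrib_right[symmetric])
    finally show ?thesis .
  qed
  moreover have "(u *\<^sub>R h1 + v *\<^sub>R h2) t = (u *\<^sub>R h1 + v *\<^sub>R h2) (clip t)" for t
    using h by (simp add: Hoelder_set_def)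
  ultimately show "u *\<^sub>R h1 + v *\<^sub>R h2 \<in> Hoelder_set \<alpha> B C"
    by (simp add: Hoelder_set_def)
qed

text \<open>Arzela-Ascoli gives a subsequence converging uniformly on \<open>{0..1}\<close>, hence
  through \<open>clip\<close> on the whole line. Each defining condition passes to the
  limit.\<close>

lemma compact_Hoelder_set:
  assumes \<alpha>: "0 < \<alpha>" and C: "0 \<le> C"
  shows "compact (Hoelder_set \<alpha> B C)"
  unfolding compact_eq_seq_compact_metric
proof (rule seq_compactI)
  fix F :: "nat \<Rightarrow> real \<Rightarrow>\<^sub>C real"
  assume "\<forall>n. F n \<in> Hoelder_set \<alpha> B C"
  then have nF: "norm (F n) \<le> B" and HF: "\<bar>F n s - F n t\<bar> \<le> C * \<bar>s - t\<bar> powr \<alpha>"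
    and cF: "F n t = F n (clip t)" for n s t
    by (auto simp: Hoelder_set_def)
  obtain g and \<sigma> :: "nat \<Rightarrow> nat" where \<sigma>: "strict_mono \<sigma>"
    and g: "\<And>e. 0 < e \<Longrightarrow> \<exists>N. \<forall>n x. n \<ge> N \<and> x \<in> {0..1} \<longrightarrow> norm (F (\<sigma> n) x - g x) < e"
  proof (rule Arzela_Ascoli[of "{0..1::real}" "\<lambda>n. apply_bcontfun (F n)" B])
    show "norm (F n x) \<le> B" for n x
      using norm_bounded[of "F n" x] nF[of n] by linarith
    fix x e :: real assume e: "0 < e"
    obtain d where d: "0 < d" "\<And>s t. \<bar>s - t\<bar> < d \<Longrightarrow> C * \<bar>s - t\<bar> powr \<alpha> < e"
      using Hoelder_modulus[OF \<alpha> C e] by metis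
    show "\<exists>d. 0 < d \<and> (\<forall>n y. y \<in> {0..1} \<and> norm (x - y) < d \<longrightarrow> norm (F n x - F n y) < e)"
      using d le_less_trans[OF HF] by (intro exI[of _ d]) auto
  qed (use that in auto)
  have "uniform_limit UNIV (\<lambda>n. F (\<sigma> n)) (\<lambda>x. g (clip x)) sequentially"
  proof (rule uniform_limitI)
    fix e :: real assume "0 < e"
    from g[OF this] obtain N where N: "\<And>n x. N \<le> n \<Longrightarrow> x \<in> {0..1} \<Longrightarrow> norm (F (\<sigma> n) x - g x) < e"
      by blast
    have "dist (F (\<sigma> n) x) (g (clip x)) < e" if "N \<le> n" for n x
      using N[OF that clip_mem[of x]] cF[of "\<sigma> n" x] by (simp add: dist_norm)
    then show "\<forall>\<^sub>F n in sequentially. \<forall>x\<in>UNIV. dist (F (\<sigma> n) x) (g (clip x)) < e"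
      using eventually_sequentially by blast
  qed
  then obtain l where l: "(\<lambda>n. F (\<sigma> n)) \<longlonglongrightarrow> l"
    by (rule uniform_limit_bcontfunE) auto
  then have pt: "(\<lambda>n. F (\<sigma> n) x) \<longlonglongrightarrow> l x" for x
    using tendsto_uniform_limitI[OF tendsto_bcontfun_uniform_limit] by blast
  have "norm l \<le> B"
    using tendsto_norm[OF l] by (rule LIMSEQ_le_const2) (use nF in auto)
  moreover have "\<bar>l s - l t\<bar> \<le> C * \<bar>s - t\<bar> powr \<alpha>" for s t
    using tendsto_rabs[OF tendsto_diff[OF pt[of s] pt[of t]]]
    by (rule LIMSEQ_le_const2) (use HF in auto)
  moreover have "l t = l (clip t)" for t
    using pt[of t] pt[of "clip t"] unfolding cF[of _ t, symmetric]  by (rule LIMSEQ_unique)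
  ultimately have "l \<in> Hoelder_set \<alpha> B C"
    by (simp add: Hoelder_set_def)
  then show "\<exists>l\<in>Hoelder_set \<alpha> B C. \<exists>r. strict_mono r \<and> (F \<circ> r) \<longlonglongrightarrow> l"
    using \<sigma> l by (auto simp: o_def)
qed

section \<open>Pointwise products\<close>

definition mult_bcontfun :: "(real \<Rightarrow>\<^sub>C real) \<Rightarrow> (real \<Rightarrow>\<^sub>C real) \<Rightarrow> real \<Rightarrow>\<^sub>C real" where
  "mult_bcontfun v w = Bcontfun (\<lambda>t. v t * w t)"

lemma mult_bcontfun_apply: "mult_bcontfun v w t = v t * w t"
proof -
  have "(\<lambda>t. v t * w t) \<in> bcontfun"
  proof (rule bcontfun_normI)
    show "norm (v t * w t) \<le> norm v * norm w" for t
      unfolding norm_mult by (intro mult_mono norm_bounded) auto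
  qed (intro continuous_intros continuous_on_apply_bcontfun)
  then show ?thesis by (simp add: mult_bcontfun_def Bcontfun_inverse)
qed

text \<open>Pointwise, \<open>v * w - v' * w' = v * (w - w') + (v - v') * w'\<close>. The case
  \<open>v = v'\<close> serves the contraction, the general case the dependence of its fixed point
  on the multiplier.\<close>

lemma dist_mult_bcontfun_le:
  "dist (mult_bcontfun v w) (mult_bcontfun v' w') \<le> norm v * dist w w' + dist v v' * norm w'"
proof (rule dist_bound)
  fix t
  have "dist (mult_bcontfun v w t) (mult_bcontfun v' w' t) = \<bar>v t * (w t - w' t) + (v t - v' t) * w' t\<bar>"
    by (simp add: mult_bcontfun_apply dist_norm algebra_simps)
  also have "\<dots> \<le> \<bar>v t\<bar> * \<bar>w t - w' t\<bar> + \<bar>v t - v' t\<bar> * \<bar>w' t\<bar>"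
    unfolding abs_mult[symmetric] by (rule abs_triangle_ineq)
  also have "\<dots> \<le> norm v * dist w w' + dist v v' * norm w'"
    using norm_bounded[of v t] norm_bounded[of w' t] dist_bounded[of w t w'] dist_bounded[of v t v']
    by (intro add_mono mult_mono) (auto simp: dist_real_def)
  finally show "dist (mult_bcontfun v w t) (mult_bcontfun v' w' t) \<le> \<dots>" .
qed

lemma norm_mult_bcontfun_le: "norm (mult_bcontfun v w) \<le> norm v * norm w"
proof (rule norm_bound)
  show "norm (mult_bcontfun v w t) \<le> norm v * norm w" for t
    using norm_bounded[of v t] norm_bounded[of w t]
    by (auto simp: mult_bcontfun_apply abs_mult intro: mult_mono)
qed

section \<open>The fractional integral as an operator\<close>

definition RL_operator :: "real \<Rightarrow> (real \<Rightarrow>\<^sub>C real) \<Rightarrow> real \<Rightarrow>\<^sub>C real" where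
  "RL_operator \<alpha> w = Bcontfun (\<lambda>t. RL_integral \<alpha> w (clip t))"

context
  fixes \<alpha> :: real
  assumes \<alpha>: "0 < \<alpha>" "\<alpha> \<le> 1"
begin

lemma RL_integral_clip_Hoelder:
  fixes w :: "real \<Rightarrow>\<^sub>C real"
  shows "\<bar>RL_integral \<alpha> w (clip s) - RL_integral \<alpha> w (clip t)\<bar>
    \<le> 2 * norm w / Gamma (\<alpha> + 1) * \<bar>s - t\<bar> powr \<alpha>"
proof -
  have G: "0 < Gamma (\<alpha> + 1)" using \<alpha> by (auto intro: Gamma_real_pos)
  have le: "\<bar>RL_integral \<alpha> w v - RL_integral \<alpha> w u\<bar> \<le> 2 * norm w / Gamma (\<alpha> + 1) * \<bar>v - u\<bar> powr \<alpha>"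
    if "0 \<le> u" "u \<le> v" for u v
    using RL_integral_Hoelder[OF \<alpha> that, of w] that by simp
  have "\<bar>RL_integral \<alpha> w (clip s) - RL_integral \<alpha> w (clip t)\<bar>
    \<le> 2 * norm w / Gamma (\<alpha> + 1) * \<bar>clip s - clip t\<bar> powr \<alpha>"
    using le[of "clip s" "clip t"] le[of "clip t" "clip s"] clip_mem[of s] clip_mem[of t]
    by (cases "clip s \<le> clip t") (auto simp: abs_minus_commute)
  also have "\<dots> \<le> 2 * norm w / Gamma (\<alpha> + 1) * \<bar>s - t\<bar> powr \<alpha>"
    using \<alpha> G abs_clip_diff_le by (intro mult_left_mono powr_mono2) auto
  finally show ?thesis .
qed

text \<open>The Hoelder estimate yields continuity, and compactness of \<open>{0..1}\<close> yields
  boundedness, so \<open>Bcontfun\<close> can be inverted here.\<close>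

lemma RL_operator_apply: "RL_operator \<alpha> w t = RL_integral \<alpha> w (clip t)"
proof -
  have "0 \<le> 2 * norm w / Gamma (\<alpha> + 1)"
    using \<alpha> Gamma_real_pos[of "\<alpha> + 1"] by simp
  then have "\<exists>d>0. \<forall>t. dist t s < d \<longrightarrow>
      dist (RL_integral \<alpha> w (clip t)) (RL_integral \<alpha> w (clip s)) < e" if "0 < e" for s e
    using Hoelder_modulus[OF \<alpha>(1) _ that] le_less_trans[OF RL_integral_clip_Hoelder]
    unfolding dist_real_def by metis
  then have "continuous_on UNIV (\<lambda>t. RL_integral \<alpha> w (clip t))"
    unfolding continuous_on_iff by blast
  then have "continuous_on {0..1} (\<lambda>t. RL_integral \<alpha> w (clip t))"
    by (rule continuous_on_subset) simp
  then have "(\<lambda>t. RL_integral \<alpha> w (clip t)) \<in> bcontfun"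
    using clip_comp_bcontfun by (fastforce simp: clip_clip)
  then show ?thesis by (simp add: RL_operator_def Bcontfun_inverse)
qed

lemma norm_RL_operator_le: "norm (RL_operator \<alpha> w) \<le> norm w / Gamma (\<alpha> + 1)"
proof (rule norm_bound)
  fix t
  have "norm (RL_operator \<alpha> w t) \<le> norm w * clip t powr \<alpha> / Gamma (\<alpha> + 1)"
    using abs_RL_integral_le[OF \<alpha>(1)] clip_mem[of t] by (simp add: RL_operator_apply)
  also have "\<dots> \<le> norm w * 1 / Gamma (\<alpha> + 1)"
    using \<alpha> clip_mem[of t] Gamma_real_pos[of "\<alpha> + 1"]
    by (intro divide_right_mono mult_left_mono powr_le1) auto
  finally show "norm (RL_operator \<alpha> w t) \<le> norm w / Gamma (\<alpha> + 1)" by simp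
qed

lemma RL_operator_diff: "RL_operator \<alpha> v - RL_operator \<alpha> w = RL_operator \<alpha> (v - w)"
  using clip_mem
  by (intro bcontfun_eqI) (simp add: RL_operator_apply RL_integral_diff[OF \<alpha>(1)])

text \<open>The compactness property of the fractional integral: a bound in the supremum norm
  becomes membership in a compact set.\<close>

lemma RL_operator_mem_Hoelder_set:
  assumes "norm w \<le> W"
  shows "RL_operator \<alpha> w \<in> Hoelder_set \<alpha> (W / Gamma (\<alpha> + 1)) (2 * W / Gamma (\<alpha> + 1))"
proof -
  have G: "0 < Gamma (\<alpha> + 1)" using \<alpha> by (auto intro: Gamma_real_pos)
  have "norm (RL_operator \<alpha> w) \<le> W / Gamma (\<alpha> + 1)"
    using norm_RL_operator_le[of w] divide_right_mono[OF assms less_imp_le[OF G]] by linarith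
  moreover have "\<bar>RL_operator \<alpha> w s - RL_operator \<alpha> w t\<bar> \<le> 2 * W / Gamma (\<alpha> + 1) * \<bar>s - t\<bar> powr \<alpha>" for s t
    unfolding RL_operator_apply using G assms
    by (intro order_trans[OF RL_integral_clip_Hoelder] mult_right_mono divide_right_mono) auto
  ultimately show ?thesis
    by (simp add: Hoelder_set_def RL_operator_apply clip_clip)
qed

end

section \<open>Superposition operators\<close>

locale superposition =
  fixes f :: "real \<Rightarrow> real \<Rightarrow> real \<Rightarrow> real" and \<psi> :: "real \<Rightarrow> real" and k :: real
  assumes f_cont: "continuous_on ({0..1} \<times> UNIV \<times> UNIV) (\<lambda>(t, x, y). f t x y)"
    and \<psi>: "continuous_on {0..1} \<psi>" "\<psi> ` {0..1} \<subseteq> {0..1}"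
    and k: "0 < k" "k < 1"
    and f_contr: "\<And>t x\<^sub>1 x\<^sub>2 y\<^sub>1 y\<^sub>2. t \<in> {0..1} \<Longrightarrow>
      \<bar>f t x\<^sub>1 y\<^sub>1 - f t x\<^sub>2 y\<^sub>2\<bar> \<le> (max \<bar>x\<^sub>1 - x\<^sub>2\<bar> \<bar>y\<^sub>1 - y\<^sub>2\<bar> + 1) powr k - 1"
begin

text \<open>Used for \<open>f\<close>, \<open>\<phi>\<close>, \<open>k\<close> as well as for
  \<open>g\<close>, \<open>\<rho>\<close>, \<open>r\<close>. \<open>clip\<close> keeps all arguments
  in the interval where the assumptions hold.\<close>

definition operator :: "(real \<Rightarrow>\<^sub>C real) \<Rightarrow> real \<Rightarrow>\<^sub>C real" where
  "operator x = Bcontfun (\<lambda>t. f (clip t) (x (clip t)) (x (\<psi> (clip t))))"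

lemma operator_apply: "operator x t = f (clip t) (x (clip t)) (x (\<psi> (clip t)))"
proof -
  have "continuous_on {0..1} (\<lambda>t. (\<lambda>(t, x, y). f t x y) (t, x t, x (\<psi> t)))"
    by (intro continuous_on_compose2[OF f_cont] continuous_on_Pair continuous_on_id
        continuous_on_apply_bcontfun continuous_on_compose2[OF continuous_on_apply_bcontfun[of UNIV x] \<psi>(1)]) auto
  then have "(\<lambda>t. f (clip t) (x (clip t)) (x (\<psi> (clip t)))) \<in> bcontfun"
    using clip_comp_bcontfun by fastforce
  then show ?thesis by (simp add: operator_def Bcontfun_inverse)
qed

text \<open>Each of the two inserted values changes by at most \<open>dist x y\<close>, and the
  modulus \<open>(d + 1) powr k - 1\<close> increases with \<open>d\<close> and is at most
  \<open>k * d\<close>.\<close>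

lemma dist_operator_le: "dist (operator x) (operator y) \<le> k * dist x y"
proof (rule dist_bound)
  fix t
  have "dist (operator x t) (operator y t) \<le>
      (max \<bar>x (clip t) - y (clip t)\<bar> \<bar>x (\<psi> (clip t)) - y (\<psi> (clip t))\<bar> + 1) powr k - 1"
    unfolding operator_apply dist_real_def by (rule f_contr[OF clip_mem])
  also have "\<dots> \<le> (dist x y + 1) powr k - 1"
    using dist_bounded[of x "clip t" y] dist_bounded[of x "\<psi> (clip t)" y] k
    by (intro diff_right_mono powr_mono2 add_right_mono) (auto simp: dist_real_def)
  also have "\<dots> \<le> k * dist x y"
    using k by (intro powr_add_one_le) auto
  finally show "dist (operator x t) (operator y t) \<le> k * dist x y" .
qed

lemma abs_zero_le_SUP: "t \<in> {0..1} \<Longrightarrow> \<bar>f t 0 0\<bar> \<le> (SUP t\<in>{0..1}. \<bar>f t 0 0\<bar>)"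
proof (rule cSUP_upper)
  have "continuous_on {0..1} (\<lambda>t. (\<lambda>(t, x, y). f t x y) (t, 0, 0))"
    by (intro continuous_on_compose2[OF f_cont] continuous_intros) auto
  then have "continuous_on {0..1} (\<lambda>t. \<bar>f t 0 0\<bar>)"
    by (auto intro: continuous_on_rabs)
  then show "bdd_above ((\<lambda>t. \<bar>f t 0 0\<bar>) ` {0..1})"
    by (intro bounded_imp_bdd_above compact_imp_bounded compact_continuous_image) auto
qed

text \<open>Comparison with the values at the zero function.\<close>

lemma norm_operator_le:
  assumes x: "norm x \<le> R"
  shows "norm (operator x) \<le> (R + 1) powr k - 1 + (SUP t\<in>{0..1}. \<bar>f t 0 0\<bar>)"
proof (rule norm_bound)
  fix t
  have "\<bar>operator x t - f (clip t) 0 0\<bar> \<le>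
      (max \<bar>x (clip t) - 0\<bar> \<bar>x (\<psi> (clip t)) - 0\<bar> + 1) powr k - 1"
    unfolding operator_apply by (rule f_contr[OF clip_mem])
  also have "\<dots> \<le> (R + 1) powr k - 1"
    using norm_bounded[of x "clip t"] norm_bounded[of x "\<psi> (clip t)"] k x
    by (intro diff_right_mono powr_mono2 add_right_mono) auto
  finally show "norm (operator x t) \<le> (R + 1) powr k - 1 + (SUP t\<in>{0..1}. \<bar>f t 0 0\<bar>)"
    using abs_zero_le_SUP[OF clip_mem[of t]] by auto
qed

end

section \<open>Existence of a solution\<close>

theorem theorem3:
  fixes \<alpha> k r K\<^sub>1 K\<^sub>2 :: real
    and f g :: "real \<Rightarrow> real \<Rightarrow> real \<Rightarrow> real"
    and \<phi> \<rho> :: "real \<Rightarrow> real"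
  assumes alpha: "0 < \<alpha>" "\<alpha> < 1"
    and f_cont: "continuous_on ({0..1} \<times> UNIV \<times> UNIV) (\<lambda>(t, x, y). f t x y)"
    and f_nonzero: "\<And>t x y. t \<in> {0..1} \<Longrightarrow> f t x y \<noteq> 0"
    and g_cont: "continuous_on ({0..1} \<times> UNIV \<times> UNIV) (\<lambda>(t, x, y). g t x y)"
    and phi: "continuous_on {0..1} \<phi>" "\<phi> ` {0..1} \<subseteq> {0..1}"
    and rho: "continuous_on {0..1} \<rho>" "\<rho> ` {0..1} \<subseteq> {0..1}"
    and k: "0 < k" "k < 1"
    and r: "0 < r" "r < 1"
    and f_contr: "\<And>t x\<^sub>1 x\<^sub>2 y\<^sub>1 y\<^sub>2. t \<in> {0..1} \<Longrightarrow>
      \<bar>f t x\<^sub>1 y\<^sub>1 - f t x\<^sub>2 y\<^sub>2\<bar> \<le> (max \<bar>x\<^sub>1 - x\<^sub>2\<bar> \<bar>y\<^sub>1 - y\<^sub>2\<bar> + 1) powr k - 1"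
    and g_contr: "\<And>t x\<^sub>1 x\<^sub>2 y\<^sub>1 y\<^sub>2. t \<in> {0..1} \<Longrightarrow>
      \<bar>g t x\<^sub>1 y\<^sub>1 - g t x\<^sub>2 y\<^sub>2\<bar> \<le> (max \<bar>x\<^sub>1 - x\<^sub>2\<bar> \<bar>y\<^sub>1 - y\<^sub>2\<bar> + 1) powr r - 1"
    and K1: "K\<^sub>1 = (SUP t\<in>{0..1}. \<bar>f t 0 0\<bar>)"
    and K2: "K\<^sub>2 = (SUP t\<in>{0..1}. \<bar>g t 0 0\<bar>)"
    and r0: "\<exists>r\<^sub>0>0.
      ((r\<^sub>0 + 1) powr k - 1 + K\<^sub>1) * ((r\<^sub>0 + 1) powr r - 1 + K\<^sub>2) \<le> r\<^sub>0 * Gamma (\<alpha> + 1) \<and>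
      (r\<^sub>0 + 1) powr r - 1 + K\<^sub>2 \<le> Gamma (\<alpha> + 1)"
  shows "\<exists>x. is_solution \<alpha> f g \<phi> \<rho> x"
proof -
  interpret F: superposition f \<phi> k
    by unfold_locales (fact f_cont phi k f_contr)+
  interpret G: superposition g \<rho> r
    by unfold_locales (fact g_cont rho r g_contr)+
  obtain R where R: "0 < R"
    and RAW: "((R + 1) powr k - 1 + K\<^sub>1) * ((R + 1) powr r - 1 + K\<^sub>2) \<le> R * Gamma (\<alpha> + 1)"
    and RW: "(R + 1) powr r - 1 + K\<^sub>2 \<le> Gamma (\<alpha> + 1)"
    using r0 by blast
  \<comment> \<open>\<open>A\<close> and \<open>W\<close> bound the two superposition operators on
    the ball of radius \<open>R\<close>; \<open>H\<close> bounds the fractional integrals of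
    functions of norm at most \<open>W\<close>.\<close>
  define A where "A = (R + 1) powr k - 1 + K\<^sub>1"
  define W where "W = (R + 1) powr r - 1 + K\<^sub>2"
  define \<Gamma> where "\<Gamma> = Gamma (\<alpha> + 1)"
  define H where "H = W / \<Gamma>"
  have \<Gamma>: "0 < \<Gamma>" using alpha by (auto simp: \<Gamma>_def intro: Gamma_real_pos)
  have FA: "norm (F.operator x) \<le> A" if "norm x \<le> R" for x
    using F.norm_operator_le[OF that] by (simp add: A_def K1)
  have GW: "norm (G.operator x) \<le> W" if "norm x \<le> R" for x
    using G.norm_operator_le[OF that] by (simp add: W_def K2)
  have A0: "0 \<le> A" and W0: "0 \<le> W"
    using order_trans[OF norm_ge_zero FA[of 0]] order_trans[OF norm_ge_zero GW[of 0]] R by simp_all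
  \<comment> \<open>The two inequalities for \<open>R\<close>, divided by \<open>\<Gamma>\<close>:
    \<open>H \<le> 1\<close> makes multiplication by \<open>h\<close> preserve the contraction
    factor \<open>k\<close>, and \<open>H * A \<le> R\<close> makes the ball invariant.\<close>
  have H0: "0 \<le> H" and H1: "H \<le> 1" and HA: "H * A \<le> R"
    using W0 RW RAW \<Gamma> by (simp_all add: H_def A_def W_def \<Gamma>_def field_simps)

  have ex1: "\<exists>!x. x \<in> cball 0 R \<and> mult_bcontfun h (F.operator x) = x" if h: "norm h \<le> H" for h
  proof (rule Banach_fix[where c = k])
    show "complete (cball (0 :: real \<Rightarrow>\<^sub>C real) R)"
      by (simp add: complete_eq_closed)
    show "(\<lambda>x. mult_bcontfun h (F.operator x)) ` cball 0 R \<subseteq> cball 0 R"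
    proof (clarsimp)
      fix x :: "real \<Rightarrow>\<^sub>C real" assume "norm x \<le> R"
      then have "norm h * norm (F.operator x) \<le> H * A"
        using h H0 by (intro mult_mono FA) auto
      then show "norm (mult_bcontfun h (F.operator x)) \<le> R"
        using norm_mult_bcontfun_le[of h "F.operator x"] HA by linarith
    qed
    fix x y
    have "dist (mult_bcontfun h (F.operator x)) (mult_bcontfun h (F.operator y))
        \<le> norm h * dist (F.operator x) (F.operator y)"
      using dist_mult_bcontfun_le[of h "F.operator x" h "F.operator y"] by simp
    also have "\<dots> \<le> 1 * (k * dist x y)"
      using h H1 by (intro mult_mono F.dist_operator_le) auto
    finally show "dist (mult_bcontfun h (F.operator x)) (mult_bcontfun h (F.operator y)) \<le> k * dist x y"
      by simp
  qed (use k R in auto)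
  define \<Phi> where "\<Phi> h = (THE x. x \<in> cball 0 R \<and> mult_bcontfun h (F.operator x) = x)" for h
  have \<Phi>R: "norm (\<Phi> h) \<le> R" and \<Phi>: "mult_bcontfun h (F.operator (\<Phi> h)) = \<Phi> h" if "norm h \<le> H" for h
    using theI'[OF ex1[OF that]] by (simp_all add: \<Phi>_def)
  \<comment> \<open>The term \<open>k * dist (\<Phi> h) (\<Phi> h')\<close> is absorbed on the left,
    whence the denominator \<open>1 - k\<close>.\<close>
  have \<Phi>_dist: "dist (\<Phi> h) (\<Phi> h') \<le> A / (1 - k) * dist h h'" if h: "norm h \<le> H" "norm h' \<le> H" for h h'
  proof -
    have "dist (\<Phi> h) (\<Phi> h') \<le> norm h * dist (F.operator (\<Phi> h)) (F.operator (\<Phi> h'))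
        + dist h h' * norm (F.operator (\<Phi> h'))"
      using dist_mult_bcontfun_le[of h "F.operator (\<Phi> h)" h' "F.operator (\<Phi> h')"] \<Phi> h by simp
    also have "\<dots> \<le> 1 * (k * dist (\<Phi> h) (\<Phi> h')) + dist h h' * A"
      using h H1 by (intro add_mono mult_mono F.dist_operator_le FA \<Phi>R) auto
    finally show ?thesis using k by (simp add: field_simps)
  qed

  \<comment> \<open>If \<open>M h = h\<close>, then \<open>x = \<Phi> h\<close> is the product of
    \<open>F.operator x\<close> and the fractional integral of \<open>G.operator x\<close>, which is
    the equation in integrated form.\<close>
  define M where "M h = RL_operator \<alpha> (G.operator (\<Phi> h))" for h
  define \<K> where "\<K> = Hoelder_set \<alpha> H (2 * W / \<Gamma>)"
  have \<K>: "norm h \<le> H" if "h \<in> \<K>" for h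
    using that by (simp add: \<K>_def Hoelder_set_def)
  have "continuous_on \<K> M"
  proof (rule lipschitz_on_continuous_on, rule lipschitz_onI)
    fix h h' assume h: "h \<in> \<K>" "h' \<in> \<K>"
    have "dist (M h) (M h') \<le> dist (G.operator (\<Phi> h)) (G.operator (\<Phi> h')) / \<Gamma>"
      unfolding M_def dist_norm \<Gamma>_def using alpha by (simp add: RL_operator_diff norm_RL_operator_le)
    also have "\<dots> \<le> r * (A / (1 - k) * dist h h') / \<Gamma>"
      using \<Gamma> r \<Phi>_dist[OF h[THEN \<K>]]
      by (intro divide_right_mono order_trans[OF G.dist_operator_le] mult_left_mono) auto
    finally show "dist (M h) (M h') \<le> r * (A / (1 - k)) / \<Gamma> * dist h h'" by simp
  qed (use r k A0 \<Gamma> in simp)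
  moreover have "M ` \<K> \<subseteq> \<K>"
    using RL_operator_mem_Hoelder_set[of \<alpha> _ W] alpha GW[OF \<Phi>R[OF \<K>]]
    by (auto simp: M_def \<K>_def H_def \<Gamma>_def)
  moreover have "0 \<in> \<K>"
    using H0 W0 \<Gamma> by (simp add: \<K>_def Hoelder_set_def)
  moreover have "compact \<K>" "convex \<K>"
    using alpha W0 \<Gamma> by (simp_all add: \<K>_def compact_Hoelder_set convex_Hoelder_set)
  ultimately obtain h where h: "h \<in> \<K>" "M h = h"
    using schauder_fixed_point[of \<K> M] by blast

  define x where "x = \<Phi> h"
  have ht: "h t = RL_integral \<alpha> (G.operator x) t" if "t \<in> {0..1}" for t
    using arg_cong[OF h(2), of "\<lambda>v. v t"] alpha that
    by (simp add: M_def RL_operator_apply clip_eq x_def)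
  have xt: "x t = h t * f t (x t) (x (\<phi> t))" if "t \<in> {0..1}" for t
    using arg_cong[OF \<Phi>[OF \<K>[OF h(1)]], of "\<lambda>v. v t"] that
    by (simp add: mult_bcontfun_apply F.operator_apply clip_eq x_def)
  \<comment> \<open>As \<open>f\<close> has no zeros, the quotient recovers
    \<open>h\<close>.\<close>
  have u: "x t / f t (x t) (x (\<phi> t)) = RL_integral \<alpha> (G.operator x) t" if "t \<in> {0..1}" for t
    using xt[OF that] ht[OF that] f_nonzero[OF that] by (metis nonzero_mult_div_cancel_right)
  \<comment> \<open>The bound on the fractional integral contains the factor
    \<open>0 powr \<alpha> = 0\<close>.\<close>
  have "h 0 = 0"
    using ht[of 0] abs_RL_integral_le[OF alpha(1), of 0 "G.operator x"] by simp
  then have "x 0 = 0"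
    using xt[of 0] by simp
  moreover have "RL_differentiable \<alpha> (\<lambda>s. x s / f s (x s) (x (\<phi> s))) t \<and>
      RL_derivative \<alpha> (\<lambda>s. x s / f s (x s) (x (\<phi> s))) t = g t (x t) (x (\<rho> t))" if "t \<in> {0<..<1}" for t
    using RL_derivative_RL_integral[OF alpha u that] that
    by (simp add: G.operator_apply clip_eq)
  ultimately show ?thesis
    unfolding is_solution_def by (intro exI[of _ "apply_bcontfun x"]) simp
qed

end
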